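(* For the function ${}_1F_2[a;b,c;\beta x]$, the following integral representation holds: $$\int_{-\infty}^{\infty}e^{-\alpha x^2}\,{}_1F_2[a;b,c;\beta x]\,dx=\sqrt{\frac{\pi}{\alpha}}\;{}_2F_4\left[\frac{a}{2},\frac{a+1}{2};\frac{b}{2},\frac{b+1}{2},\frac{c}{2},\frac{c+1}{2};\left(\frac{\beta^2}{16\alpha}\right)\right].$$
   Context: Here $a,b,c,\alpha,\beta$ are parameters. The Pochhammer symbol is $(d)_r=\Gamma(d+r)/\Gamma(d)$. The generalized hypergeometric function is defined by the series $${}_pF_q[a_1,\dots,a_p;b_1,\dots,b_q;x]=\sum_{r=0}^{\infty}\frac{(a_1)_r\cdots(a_p)_r}{(b_1)_r\cdots(b_q)_r}\,\frac{x^r}{r!}.$$ *)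

theory Defs
  imports "HOL-Analysis.Analysis"
begin

definition hypergeometric ::
    "'a list \<Rightarrow> 'a list \<Rightarrow> 'a \<Rightarrow> 'a :: {banach, real_normed_field}" where
  "hypergeometric as bs x = eval_fps (fps_hypergeo as bs 1) x"

text \<open>
  The lemma below is the usual series. Division by zero gives zero, so the value is meaningful only
  if no element of \<open>bs\<close> is a nonpositive integer, and only where the series converges (which is
  everywhere if \<open>length as \<le> length bs\<close>).
\<close>

lemma hypergeometric_series:
  "hypergeometric as bs x =
     (\<Sum>r. (\<Prod>a\<leftarrow>as. pochhammer a r) / (\<Prod>b\<leftarrow>bs. pochhammer b r) * (x ^ r / fact r))"
proof -
  have *: "foldl (\<lambda>s a. s * pochhammer a r) y as = y * (\<Prod>a\<leftarrow>as. pochhammer a r)"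
    for y :: 'a and as r
    by (induction as arbitrary: y) (simp_all add: mult.assoc)
  show ?thesis
    unfolding hypergeometric_def eval_fps_def
    by (simp add: fps_hypergeo_nth * divide_simps)
qed

end

theory Submission
  imports Defs "HOL-Probability.Distributions" "HOL-Complex_Analysis.Conformal_Mappings"
begin

text \<open>
  The partial sums of the series for \<open>\<^sub>1F\<^sub>2[a; b, c; \<beta> x]\<close> are dominated by \<open>exp (K \<bar>x\<bar>)\<close>, which is
  integrable against a Gaussian, so the series can be integrated term by term. The odd moments
  of the Gaussian vanish. The even ones are known for real \<open>\<alpha> > 0\<close>, and since they are holomorphic
  in \<open>\<alpha>\<close> they are determined on the right half-plane by analytic continuation, which also selects
  the principal square root. The duplication formula for Pochhammer symbols does the rest.
\<close>

section \<open>Gaussian moments with complex parameter\<close>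

lemma integrable_exp_neg_square:
  fixes r :: real
  assumes "r > 0"
  shows "integrable lborel (\<lambda>x. exp (- r * x\<^sup>2))"
proof -
  have "integrable lborel (\<lambda>x::real. exp (- x\<^sup>2))"
    using has_bochner_integral_even_function[OF gaussian_moment_0] by (auto intro: integrable.intros)
  from lborel_integrable_real_affine[OF this, of "sqrt r" 0] show ?thesis
    using assms by (simp add: power_mult_distrib)
qed

text \<open>Completing the square gives \<open>K * \<bar>x\<bar> \<le> K\<^sup>2 / (2 * r) + (r / 2)
  * x\<^sup>2\<close>: half of the Gaussian decay absorbs the linear exponential, and the other half
  stays integrable.\<close>

lemma integrable_exp_neg_square_abs:
  fixes r K :: real
  assumes "r > 0"
  shows "integrable lborel (\<lambda>x. exp (K * \<bar>x\<bar> - r * x\<^sup>2))"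
proof (rule Bochner_Integration.integrable_bound)
  show "integrable lborel (\<lambda>x. exp (K\<^sup>2 / (2 * r)) * exp (- (r / 2) * x\<^sup>2))"
    using assms by (intro integrable_mult_right integrable_exp_neg_square) auto
  have "K * \<bar>x\<bar> - r * x\<^sup>2 \<le> K\<^sup>2 / (2 * r) + - (r / 2) * x\<^sup>2" for x :: real
  proof -
    have "0 \<le> (K - r * \<bar>x\<bar>)\<^sup>2" by simp
    also have "\<dots> = K\<^sup>2 - 2 * r * (K * \<bar>x\<bar>) + r\<^sup>2 * x\<^sup>2"
      by (simp add: power2_diff power_mult_distrib)
    finally show ?thesis
      using assms by (simp add: field_simps power2_eq_square)
  qed
  then show "AE x in lborel. norm (exp (K * \<bar>x\<bar> - r * x\<^sup>2))
      \<le> norm (exp (K\<^sup>2 / (2 * r)) * exp (- (r / 2) * x\<^sup>2))"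
    by (simp flip: exp_add)
qed measurable

text \<open>One term of the exponential series is at most its sum, since all terms are nonnegative.
  With it, moments are dominated by the preceding bound at \<open>K = 1\<close>.\<close>

lemma power_le_fact_exp:
  fixes x :: real
  assumes "x \<ge> 0"
  shows "x ^ k \<le> fact k * exp x"
proof -
  have "x ^ k / fact k \<le> (\<Sum>n. x ^ n / fact n)"
    using sum_le_suminf[OF summable_exp_generic[of x], of "{k}"] assms
    by (simp add: divide_inverse mult_ac)
  also have "\<dots> = exp x"
    by (simp add: exp_def divide_inverse mult_ac)
  finally show ?thesis by (simp add: field_simps)
qed

lemma integrable_gaussian_abs_moment:
  fixes r :: real
  assumes "r > 0"
  shows "integrable lborel (\<lambda>x. exp (- r * x\<^sup>2) * \<bar>x\<bar> ^ k)"
proof (rule Bochner_Integration.integrable_bound)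
  show "integrable lborel (\<lambda>x. fact k * exp (1 * \<bar>x\<bar> - r * x\<^sup>2))"
    using assms by (intro integrable_mult_right integrable_exp_neg_square_abs)
  show "AE x in lborel. norm (exp (- r * x\<^sup>2) * \<bar>x\<bar> ^ k) \<le> norm (fact k * exp (1 * \<bar>x\<bar> - r * x\<^sup>2))"
    using power_le_fact_exp[of "\<bar>x\<bar>" k for x]
    by (auto simp: exp_diff exp_minus field_simps)
qed measurable

lemma norm_exp_neg_square:
  "norm (exp (- \<alpha> * of_real x ^ 2)) = exp (- Re \<alpha> * x\<^sup>2)"
  by (simp add: norm_exp_eq_Re flip: of_real_power)

lemma integrable_gaussian_moment:
  fixes \<alpha> :: complex
  assumes "Re \<alpha> > 0"
  shows "integrable lborel (\<lambda>x::real. exp (- \<alpha> * of_real x ^ 2) * of_real x ^ k)"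
proof (rule Bochner_Integration.integrable_bound)
  show "integrable lborel (\<lambda>x. exp (- Re \<alpha> * x\<^sup>2) * \<bar>x\<bar> ^ k)"
    by (rule integrable_gaussian_abs_moment[OF assms])
qed (auto simp: norm_mult norm_power power_abs norm_exp_eq_Re simp flip: of_real_power)

text \<open>The substitution of -x for x turns the integral into its own negative. For divergent
  integrals the Bochner integral is 0 by convention, so every \<alpha> is covered.\<close>

lemma gaussian_moment_odd:
  fixes \<alpha> :: complex
  assumes "odd k"
  shows "(LBINT x::real. exp (- \<alpha> * of_real x ^ 2) * of_real x ^ k) = 0"
proof -
  let ?I = "LBINT x::real. exp (- \<alpha> * of_real x ^ 2) * of_real x ^ k"
  have "?I = (LBINT x::real. - (exp (- \<alpha> * of_real x ^ 2) * of_real x ^ k))"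
    using lborel_integral_real_affine[of "-1" "\<lambda>x::real. exp (- \<alpha> * of_real x ^ 2) * of_real x ^ k" 0]
      assms by simp
  then have "?I = - ?I"
    by (simp add: Bochner_Integration.integral_minus)
  then show ?thesis by simp
qed

text \<open>The case \<open>r = 1\<close> is the library moment on the half-line, doubled by
  symmetry, with (2k)! rewritten through the Pochhammer symbol at 1/2. Rescaling by
  \<open>sqrt r\<close> gives the rest.\<close>

lemma gaussian_moment_even_real:
  fixes r :: real
  assumes "r > 0"
  shows "(LBINT x. exp (- r * x\<^sup>2) * x ^ (2 * k)) = sqrt (pi / r) * pochhammer (1 / 2) k / r ^ k"
proof -
  have "has_bochner_integral lborel (\<lambda>x::real. exp (- x\<^sup>2) * x ^ (2 * k))
      (sqrt pi * pochhammer (1 / 2) k)"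
    using has_bochner_integral_even_function[OF gaussian_moment_even_pos[where k = k]]
    by (simp add: fact_double)
  then have I: "(LBINT x::real. exp (- x\<^sup>2) * x ^ (2 * k)) = sqrt pi * pochhammer (1 / 2) k"
    by (rule has_bochner_integral_integral_eq)
  have scale: "(sqrt r * x) ^ (2 * k) = r ^ k * x ^ (2 * k)" "(sqrt r * x)\<^sup>2 = r * x\<^sup>2" for x
    using assms by (simp_all add: power_mult_distrib power_mult)
  have "sqrt pi * pochhammer (1 / 2) k =
      sqrt r * (LBINT x. r ^ k * (exp (- r * x\<^sup>2) * x ^ (2 * k)))"
    unfolding I[symmetric]
    using assms
    by (subst lborel_integral_real_affine[of "sqrt r" _ 0]) (auto simp: scale mult.left_commute)
  then show ?thesis
    using assms by (simp add: field_simps real_sqrt_divide)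
qed

text \<open>Differentiation under the integral sign, made quantitative: the second-order remainder
  of the exponential yields an error of order h^2, uniformly for small h.\<close>

lemma gaussian_moment_has_field_derivative:
  fixes \<alpha> :: complex
  assumes "Re \<alpha> > 0"
  defines "M \<equiv> \<lambda>k \<alpha>. LBINT x::real. exp (- \<alpha> * of_real x ^ 2) * of_real x ^ k"
  shows "(M k has_field_derivative - M (k + 2) \<alpha>) (at \<alpha>)"
proof -
  \<comment> \<open>For \<open>norm h < r\<close> the perturbation costs at most a factor
    \<open>exp (r * x\<^sup>2)\<close>, leaving the decay \<open>exp (- r * x\<^sup>2)\<close>. The
    exponent \<open>k + 4\<close> in \<open>C\<close> comes from x^k and the squared remainder
    variable, which is of order x^2.\<close>
  define r where "r = Re \<alpha> / 2"
  have r: "r > 0" using assms(1) by (simp add: r_def)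
  define C where "C = (LBINT x. exp (- r * x\<^sup>2) * \<bar>x\<bar> ^ (k + 4))"
  have bound: "norm (M k (\<alpha> + h) - M k \<alpha> + h * M (k + 2) \<alpha>) \<le> C * norm h ^ 2"
    if h: "norm h < r" for h
  proof -
    have Re: "Re (\<alpha> + h) > 0"
      using h abs_Re_le_cmod[of h] r unfolding r_def plus_complex.sel by linarith
    let ?f = "\<lambda>\<alpha> k (x::real). exp (- \<alpha> * of_real x ^ 2) * of_real x ^ k :: complex"
    let ?g = "\<lambda>x. ?f (\<alpha> + h) k x - ?f \<alpha> k x + h * ?f \<alpha> (k + 2) x"
    note int = integrable_gaussian_moment[OF Re] integrable_gaussian_moment[OF assms(1)]
    have eq: "M k (\<alpha> + h) - M k \<alpha> + h * M (k + 2) \<alpha> = (LBINT x. ?g x)"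
      unfolding M_def
      by (subst Bochner_Integration.integral_add Bochner_Integration.integral_diff
          Bochner_Integration.integral_mult_right_zero;
          (intro int integrable_mult_right Bochner_Integration.integrable_diff)?)+ (rule refl)
    have le: "norm (?g x) \<le> norm h ^ 2 * (exp (- r * x\<^sup>2) * \<bar>x\<bar> ^ (k + 4))" for x
    proof -
      \<comment> \<open>In this variable \<open>?g x\<close> is the integrand at \<alpha> times the
        Taylor remainder \<open>exp z - (1 + z)\<close>.\<close>
      define z where "z = - h * of_real x ^ 2"
      have nz: "norm z = norm h * x\<^sup>2"
        by (simp add: z_def norm_mult norm_power)
      have exp_split: "exp (- (\<alpha> + h) * of_real x ^ 2) = exp (- \<alpha> * of_real x ^ 2) * exp z"
        unfolding z_def exp_add[symmetric] by (simp add: ring_distribs)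
      have "?g x = exp (- \<alpha> * of_real x ^ 2) * of_real x ^ k * (exp z - (1 + z))"
        unfolding exp_split by (simp add: z_def power_add power2_eq_square ring_distribs mult_ac)
      then have "norm (?g x) = exp (- Re \<alpha> * x\<^sup>2) * \<bar>x\<bar> ^ k * norm (exp z - (1 + z))"
        by (simp only: norm_mult norm_exp_neg_square norm_power norm_of_real)
      also have "norm (exp z - (1 + z)) \<le> exp (norm z) * norm z ^ 2"
        using Taylor_exp_field[of z 1] by (simp add: numeral_2_eq_2)
      also have "\<dots> \<le> exp (r * x\<^sup>2) * (norm h ^ 2 * \<bar>x\<bar> ^ 4)"
        unfolding nz using h
        by (intro mult_mono) (auto simp: mult_right_mono power_mult_distrib simp flip: power_mult)
      finally have "norm (?g x)
          \<le> exp (- Re \<alpha> * x\<^sup>2) * \<bar>x\<bar> ^ k * (exp (r * x\<^sup>2) * (norm h ^ 2 * \<bar>x\<bar> ^ 4))"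
        by (simp add: mult_left_mono)
      also have "\<dots> = norm h ^ 2 * (exp (- Re \<alpha> * x\<^sup>2 + r * x\<^sup>2) * \<bar>x\<bar> ^ (k + 4))"
        by (simp only: exp_add power_add mult_ac)
      also have "- Re \<alpha> * x\<^sup>2 + r * x\<^sup>2 = - r * x\<^sup>2"
        by (simp add: r_def field_simps)
      finally show ?thesis .
    qed
    have "norm (LBINT x. ?g x) \<le> (LBINT x. norm (?g x))"
      by (rule integral_norm_bound)
    also have "\<dots> \<le> (LBINT x. norm h ^ 2 * (exp (- r * x\<^sup>2) * \<bar>x\<bar> ^ (k + 4)))"
      by (intro integral_mono integrable_mult_right integrable_gaussian_abs_moment r integrable_norm
          Bochner_Integration.integrable_add Bochner_Integration.integrable_diff int le)
    also have "\<dots> = C * norm h ^ 2"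
      by (simp add: C_def)
    finally show ?thesis unfolding eq .
  qed
  have "((\<lambda>h. (M k (\<alpha> + h) - M k \<alpha>) / h - - M (k + 2) \<alpha>) \<longlongrightarrow> 0) (at 0)"
  proof (rule Lim_null_comparison)
    show "\<forall>\<^sub>F h in at 0. norm ((M k (\<alpha> + h) - M k \<alpha>) / h - - M (k + 2) \<alpha>) \<le> C * norm h"
      unfolding eventually_at
    proof (intro exI conjI ballI impI)
      fix h :: complex
      assume "h \<noteq> 0 \<and> dist h 0 < r"
      then have h: "h \<noteq> 0" "norm h < r" by auto
      have "(M k (\<alpha> + h) - M k \<alpha>) / h - - M (k + 2) \<alpha>
          = (M k (\<alpha> + h) - M k \<alpha> + h * M (k + 2) \<alpha>) / h"
        using h by (simp add: field_simps)
      then show "norm ((M k (\<alpha> + h) - M k \<alpha>) / h - - M (k + 2) \<alpha>) \<le> C * norm h"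
        using bound[OF h(2)] h(1)
        by (simp add: norm_divide divide_le_eq power2_eq_square mult_ac)
    qed (use r in auto)
    show "((\<lambda>h. C * norm h) \<longlongrightarrow> 0) (at (0::complex))"
      by (auto intro!: tendsto_eq_intros)
  qed
  then show ?thesis
    unfolding DERIV_def by (rule LIM_zero_cancel)
qed

text \<open>Both sides are holomorphic on the right half-plane and agree on the positive reals, so
  the identity theorem applies.\<close>

lemma gaussian_moment_even:
  fixes \<alpha> :: complex
  assumes "Re \<alpha> > 0"
  shows "(LBINT x::real. exp (- \<alpha> * of_real x ^ 2) * of_real x ^ (2 * k)) =
    csqrt (of_real pi / \<alpha>) * pochhammer (1 / 2) k / \<alpha> ^ k"
proof -
  define S where "S = {z. Re z > 0}"
  define M where "M = (\<lambda>\<alpha>. LBINT x::real. exp (- \<alpha> * of_real x ^ 2) * of_real x ^ (2 * k) :: complex)"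
  define g where "g = (\<lambda>\<alpha>. csqrt (of_real pi / \<alpha>) * pochhammer (1 / 2) k / \<alpha> ^ k)"
  have S: "open S" "connected S"
    unfolding S_def by (auto intro: open_halfspace_Re_gt convex_connected convex_halfspace_Re_gt)
  have "M holomorphic_on S"
    using gaussian_moment_has_field_derivative[where k = "2 * k"] S(1)
    by (auto simp: M_def S_def holomorphic_on_open)
  \<comment> \<open>Inversion preserves the right half-plane, so the argument of
    \<open>csqrt\<close> avoids the branch cut.\<close>
  moreover have "of_real pi / z \<notin> \<real>\<^sub>\<le>\<^sub>0" if "z \<in> S" for z
  proof -
    have "Re (of_real pi / z) > 0"
      using that by (auto simp: S_def Re_divide sum_power2_gt_zero_iff intro!: divide_pos_pos)
    then show ?thesis by (auto simp: complex_nonpos_Reals_iff)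
  qed
  then have "g holomorphic_on S"
    unfolding g_def by (intro holomorphic_intros) (auto simp: S_def)
  ultimately have hol: "(\<lambda>z. M z - g z) holomorphic_on S"
    by (rule holomorphic_on_diff)
  have zero: "M z - g z = 0" if z: "z \<in> of_real ` {0<..}" for z
  proof -
    obtain r where r: "r > 0" "z = of_real r" using z by auto
    have "M z = of_real (LBINT x. exp (- r * x\<^sup>2) * x ^ (2 * k))"
      unfolding M_def r(2) integral_complex_of_real[symmetric]
      by (intro Bochner_Integration.integral_cong) (auto simp: exp_of_real[symmetric])
    also have "\<dots> = g z"
      using r csqrt_of_real[of "pi / r"] pochhammer_of_real[of "1 / 2" k, where ?'a = complex]
      by (subst gaussian_moment_even_real) (auto simp: g_def)
    finally show ?thesis by simp
  qed
  have lim: "1 islimpt complex_of_real ` {0<..}"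
    unfolding islimpt_approachable
  proof (intro allI impI)
    fix e :: real assume "e > 0"
    then show "\<exists>x'\<in>complex_of_real ` {0<..}. x' \<noteq> 1 \<and> dist x' 1 < e"
      by (intro bexI[of _ "of_real (1 + e / 2)"] imageI) (auto simp: dist_norm)
  qed
  have "M \<alpha> - g \<alpha> = 0"
    by (rule analytic_continuation[OF hol S _ _ lim zero]) (use assms in \<open>auto simp: S_def\<close>)
  then show ?thesis by (simp add: M_def g_def)
qed

section \<open>Termwise integration\<close>

text \<open>The quotient of consecutive terms tends to 0 and is therefore bounded by some
  \<open>K\<close>; induction multiplies these bounds. Together with 1/n! this gives the exponential
  majorant needed for termwise integration.\<close>

lemma pochhammer_ratio_bound:
  fixes a b c :: complex
  assumes "b \<notin> \<int>\<^sub>\<le>\<^sub>0" "c \<notin> \<int>\<^sub>\<le>\<^sub>0"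
  obtains K where
    "\<And>n. norm (pochhammer a n / (pochhammer b n * pochhammer c n)) \<le> K ^ n"
proof -
  have nz: "d + of_nat n \<noteq> 0" if "d \<notin> \<int>\<^sub>\<le>\<^sub>0" for d :: complex and n
    using that plus_of_nat_eq_0_imp by blast
  have inv: "(\<lambda>n. inverse (d + of_nat n)) \<longlonglongrightarrow> 0" for d :: complex
    by (intro filterlim_compose[OF tendsto_inverse_0] 
        tendsto_add_filterlim_at_infinity[OF tendsto_const tendsto_of_nat])
  \<comment> \<open>The quotient of consecutive terms, with (a + n)/(b + n) written as 1 + (a -
    b)/(b + n) so that its limit can be read off.\<close>
  define u where "u = (\<lambda>n. (1 + (a - b) * inverse (b + of_nat n)) * inverse (c + of_nat n))"
  have u: "u n = (a + of_nat n) / ((b + of_nat n) * (c + of_nat n))" for n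
    using nz[OF assms(1), of n] nz[OF assms(2), of n] by (simp add: u_def field_simps)
  have "u \<longlonglongrightarrow> (1 + (a - b) * 0) * 0"
    unfolding u_def by (intro tendsto_intros inv)
  then have "Bseq u"
    by (intro convergent_imp_Bseq convergentI)
  then obtain K where K: "K > 0" "\<And>n. norm (u n) \<le> K"
    by (auto simp: Bseq_def)
  have "norm (pochhammer a n / (pochhammer b n * pochhammer c n)) \<le> K ^ n" for n
  proof (induction n)
    case (Suc n)
    have "pochhammer a (Suc n) / (pochhammer b (Suc n) * pochhammer c (Suc n))
        = u n * (pochhammer a n / (pochhammer b n * pochhammer c n))"
      by (simp add: u pochhammer_Suc mult_ac)
    then show ?case
      using K Suc by (simp only: norm_mult power_Suc) (intro mult_mono, auto)
  qed simp
  then show ?thesis by (rule that)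
qed

text \<open>Dominated convergence: by the coefficient bound, every partial sum times the Gaussian
  stays below \<open>exp (K * \<bar>x\<bar> - Re \<alpha> * x\<^sup>2)\<close>.\<close>

lemma gaussian_integral_power_series:
  fixes t :: "nat \<Rightarrow> complex" and \<alpha> :: complex
  assumes \<alpha>: "Re \<alpha> > 0" and t: "\<And>n. norm (t n) \<le> K ^ n / fact n"
  defines "f \<equiv> \<lambda>x::real. exp (- \<alpha> * of_real x ^ 2) * (\<Sum>n. t n * of_real x ^ n)"
  shows "integrable lborel f"
    and "(\<lambda>k. csqrt (of_real pi / \<alpha>) * (t (2 * k) * (pochhammer (1 / 2) k / \<alpha> ^ k))) sums
      (LBINT x. f x)"
proof -
  define s where "s = (\<lambda>N (x::real). exp (- \<alpha> * of_real x ^ 2) * (\<Sum>n<N. t n * of_real x ^ n))"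
  define w where "w = (\<lambda>x. exp (K * \<bar>x\<bar> - Re \<alpha> * x\<^sup>2))"
  have term_le: "norm (t n * of_real x ^ n) \<le> (K * \<bar>x\<bar>) ^ n / fact n" for n and x :: real
    using mult_right_mono[OF t[of n], of "\<bar>x\<bar> ^ n"]
    by (simp add: norm_mult norm_power power_mult_distrib)
  have K: "(\<lambda>n. (K * \<bar>x\<bar>) ^ n / fact n) sums exp (K * \<bar>x\<bar>)" for x :: real
    using exp_converges[of "K * \<bar>x\<bar>"] by (simp add: divide_inverse mult_ac)
  have summable: "summable (\<lambda>n. t n * of_real x ^ n)" for x :: real
    by (rule summable_comparison_test'[OF sums_summable[OF K[of x]], of 0]) (rule term_le)
  have bound: "norm (s N x) \<le> w x" for N x
  proof -
    \<comment> \<open>The sign of \<open>K\<close> is not fixed; nonnegativity follows because the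
      quantity bounds a norm.\<close>
    have nonneg: "0 \<le> (K * \<bar>x\<bar>) ^ n / fact n" for n
      using term_le[of n x] norm_ge_zero order_trans by blast
    have "norm (\<Sum>n<N. t n * of_real x ^ n) \<le> (\<Sum>n<N. (K * \<bar>x\<bar>) ^ n / fact n)"
      by (intro order_trans[OF norm_sum] sum_mono term_le)
    also have "\<dots> \<le> exp (K * \<bar>x\<bar>)"
      using sum_le_suminf[OF sums_summable[OF K[of x]], of "{..<N}"] nonneg sums_unique[OF K[of x]]
      by auto
    finally show ?thesis
      unfolding s_def w_def norm_mult norm_exp_neg_square
      by (simp add: exp_diff exp_minus field_simps)
  qed
  have lim: "(\<lambda>N. s N x) \<longlonglongrightarrow> f x" for x
    unfolding s_def f_def by (intro tendsto_intros summable_LIMSEQ summable)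
  have meas: "s N \<in> borel_measurable lborel" for N
    unfolding s_def by measurable
  have "f \<in> borel_measurable lborel"
    using borel_measurable_LIMSEQ_metric[OF meas lim] .
  note dom = this meas integrable_exp_neg_square_abs[OF \<alpha>, of K, folded w_def]
    AE_I2[OF lim] AE_I2[OF bound]
  show "integrable lborel f"
    by (rule integrable_dominated_convergence[OF dom])
  \<comment> \<open>Along partial sums of even length the terms pair up as 2k and 2k + 1, and the
    odd one integrates to 0.\<close>
  have "(\<lambda>N. LBINT x. s (2 * N) x) \<longlonglongrightarrow> (LBINT x. f x)"
    using integral_dominated_convergence[OF dom]
    by (rule LIMSEQ_subseq_LIMSEQ[unfolded o_def]) (auto simp: strict_mono_def)
  also have "(\<lambda>N. LBINT x. s (2 * N) x) =
      (\<lambda>N. \<Sum>k<N. csqrt (of_real pi / \<alpha>) * (t (2 * k) * (pochhammer (1 / 2) k / \<alpha> ^ k)))"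
  proof
    fix N
    define m where "m = (\<lambda>n. LBINT x::real. exp (- \<alpha> * of_real x ^ 2) * of_real x ^ n :: complex)"
    have m_odd: "m (Suc (2 * k)) = 0" for k
      unfolding m_def by (rule gaussian_moment_odd) simp
    have "(LBINT x. s N x) = (\<Sum>n<N. t n * m n)" for N
    proof -
      have "s N = (\<lambda>x. \<Sum>n<N. t n * (exp (- \<alpha> * of_real x ^ 2) * of_real x ^ n))"
        by (simp add: s_def sum_distrib_left mult_ac fun_eq_iff)
      then show ?thesis
        using integrable_gaussian_moment[OF \<alpha>] by (simp add: m_def)
    qed
    then have "(LBINT x. s (2 * N) x) = (\<Sum>n<2 * N. t n * m n)" .
    also have "\<dots> = (\<Sum>k<N. t (2 * k) * m (2 * k))"
      by (induction N) (auto simp: m_odd)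
    also have "\<dots> = (\<Sum>k<N. csqrt (of_real pi / \<alpha>) *
        (t (2 * k) * (pochhammer (1 / 2) k / \<alpha> ^ k)))"
      unfolding m_def gaussian_moment_even[OF \<alpha>] by (simp add: mult_ac)
    finally show "(LBINT x. s (2 * N) x) = \<dots>" .
  qed
  finally show "(\<lambda>k. csqrt (of_real pi / \<alpha>) * (t (2 * k) * (pochhammer (1 / 2) k / \<alpha> ^ k))) sums
      (LBINT x. f x)"
    by (simp add: sums_def)
qed

section \<open>Duplication formula and identification of the integrated series\<close>

lemma pochhammer_double_half:
  fixes a :: complex
  shows "pochhammer a (2 * k) = 4 ^ k * (pochhammer (a / 2) k * pochhammer ((a + 1) / 2) k)"
  using pochhammer_double[of "a / 2" k] by (simp add: power_mult add_divide_distrib)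

theorem theorem1:
  fixes a b c \<alpha> \<beta> :: complex
  assumes "Re \<alpha> > 0"
    and "b \<notin> \<int>\<^sub>\<le>\<^sub>0" and "c \<notin> \<int>\<^sub>\<le>\<^sub>0"
  shows "integrable lborel
           (\<lambda>x::real. exp (- \<alpha> * of_real x ^ 2) * hypergeometric [a] [b, c] (\<beta> * of_real x)) \<and>
         (LBINT x::real. exp (- \<alpha> * of_real x ^ 2) * hypergeometric [a] [b, c] (\<beta> * of_real x)) =
           csqrt (of_real pi / \<alpha>) *
           hypergeometric [a / 2, (a + 1) / 2]
             [b / 2, (b + 1) / 2, c / 2, (c + 1) / 2] (\<beta>\<^sup>2 / (16 * \<alpha>))"
proof -
  \<comment> \<open>Powers of \<beta> are absorbed into the coefficients, leaving a power series in
    x with bound constant \<open>K * norm \<beta>\<close>.\<close>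
  define t where "t = (\<lambda>n. pochhammer a n / (pochhammer b n * pochhammer c n) * (\<beta> ^ n / fact n))"
  obtain K where K:
    "\<And>n. norm (pochhammer a n / (pochhammer b n * pochhammer c n)) \<le> K ^ n"
    by (rule pochhammer_ratio_bound[OF assms(2,3), where a = a]) blast
  have t: "norm (t n) \<le> (K * norm \<beta>) ^ n / fact n" for n
    using mult_right_mono[OF K[of n], of "norm \<beta> ^ n / fact n"]
    by (simp add: t_def norm_mult norm_divide norm_power power_mult_distrib)
  have hyp: "hypergeometric [a] [b, c] (\<beta> * of_real x) = (\<Sum>n. t n * of_real x ^ n)" for x :: real
    by (simp add: hypergeometric_series t_def power_mult_distrib mult_ac)
  note series = gaussian_integral_power_series[OF assms(1) t]
  let ?h = "\<lambda>k. t (2 * k) * (pochhammer (1 / 2) k / \<alpha> ^ k)"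
  \<comment> \<open>Duplication contributes 4^k from \<open>a\<close>, 16^k from \<open>b\<close>
    and \<open>c\<close> in the denominator, and another 4^k there from (2k)!, which leaves 1/16^k.
    The Pochhammer symbol at 1/2 from the moment cancels the one in (2k)!.\<close>
  have "?h k = (\<Prod>d\<leftarrow>[a / 2, (a + 1) / 2]. pochhammer d k) /
      (\<Prod>d\<leftarrow>[b / 2, (b + 1) / 2, c / 2, (c + 1) / 2]. pochhammer d k) *
      ((\<beta>\<^sup>2 / (16 * \<alpha>)) ^ k / fact k)" for k
  proof -
    \<comment> \<open>It is a factor of the nonzero number (2k)!.\<close>
    have half: "pochhammer (1 / 2 :: complex) k \<noteq> 0"
      using fact_double[of k, where ?'a = complex] by auto
    have "(16::complex) ^ k = 4 ^ k * 4 ^ k"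
      by (simp flip: power_mult_distrib)
    then show ?thesis
      using half unfolding t_def pochhammer_double_half fact_double power_mult
      by (simp add: power_divide power_mult_distrib mult_ac)
  qed
  then have "hypergeometric [a / 2, (a + 1) / 2] [b / 2, (b + 1) / 2, c / 2, (c + 1) / 2]
      (\<beta>\<^sup>2 / (16 * \<alpha>)) = (\<Sum>k. ?h k)"
    by (simp only: hypergeometric_series)
  \<comment> \<open>Summability is known only with this prefactor included; being nonzero, it can be
    cancelled and then pulled out of the sum.\<close>
  moreover have "csqrt (of_real pi / \<alpha>) \<noteq> 0"
    using assms(1) by auto
  then have "summable ?h"
    using sums_summable[OF series(2)] by (rule summable_mult_D[rotated])
  then have "(LBINT x::real. exp (- \<alpha> * of_real x ^ 2) * (\<Sum>n. t n * of_real x ^ n)) =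
      csqrt (of_real pi / \<alpha>) * (\<Sum>k. ?h k)"
    unfolding sums_unique[OF series(2)] by (rule suminf_mult)
  ultimately show ?thesis
    unfolding hyp using series(1) by (simp only:)
qed

end
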